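(* Let $G$ be a compact abelian group, let $t_1,\dots,t_r\in G\setminus\{0\}$ and $D=\{t_1,\dots,t_r\}$. Suppose the lattice $\Lambda=\{n\in\mathbb{Z}^r: n_1t_1+\cdots+n_rt_r=0\}$ has rank $1$, and let $m=(m_1,\dots,m_r)\in\mathbb{Z}^r$ be a generator of $\Lambda$. Then, with $\|m\|_{\ell^1}=\sum_{i=1}^r|m_i|$, $$\mathrm{Md}_G(D)=\frac{\lfloor \|m\|_{\ell^1}/2\rfloor}{\|m\|_{\ell^1}}.$$
   Context: $\mu$ denotes the Haar probability measure on the compact (Hausdorff) abelian group $G$. The Motzkin density is $\mathrm{Md}_G(D)=\sup\{\mu(A): A\subset G \text{ Borel},\ (A-A)\cap D=\emptyset\}$. *)

theory Defs
  imports "HOL-Probability.Probability"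
begin

definition zsmul :: "int \<Rightarrow> 'a::ab_group_add \<Rightarrow> 'a" where
  "zsmul k x = (if 0 \<le> k then (((+) x) ^^ nat k) 0 else - ((((+) x) ^^ nat (- k)) 0))"

definition haar_prob :: "'a::{topological_ab_group_add, t2_space} measure \<Rightarrow> bool" where
  "haar_prob \<mu> \<longleftrightarrow> prob_space \<mu> \<and> sets \<mu> = sets borel \<and>
     (\<forall>A \<in> sets borel. \<forall>x. emeasure \<mu> ((+) x ` A) = emeasure \<mu> A) \<and>
     (\<forall>A \<in> sets borel. emeasure \<mu> A = (INF U \<in> {U. open U \<and> A \<subseteq> U}. emeasure \<mu> U)) \<and>
     (\<forall>U. open U \<longrightarrow> emeasure \<mu> U = (SUP K \<in> {K. compact K \<and> K \<subseteq> U}. emeasure \<mu> K))"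

definition motzkin_density :: "'a::{topological_ab_group_add, t2_space} measure \<Rightarrow> 'a set \<Rightarrow> real" where
  "motzkin_density \<mu> D =
     Sup {measure \<mu> A | A. A \<in> sets borel \<and> {a - b | a b. a \<in> A \<and> b \<in> A} \<inter> D = {}}"

end

theory Submission
  imports Defs "HOL-Real_Asymp.Real_Asymp"
begin

text \<open>
  Put \<open>N = \<parallel>m\<parallel>\<^sub>1\<close> and \<open>L = \<lfloor>N/2\<rfloor>\<close>.

  Upper bound: the relation \<open>m\<close> is a closed walk \<open>x\<^sub>0, \<dots>, x\<^sub>N = x\<^sub>0\<close> with steps \<open>\<plusminus>t\<^sub>i\<close>. Consecutive sets
  \<open>x\<^sub>j + A\<close> are disjoint, so a point lies in at most \<open>L\<close> of these \<open>N\<close> translates.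

  Lower bound: there is a homomorphism \<open>\<psi>\<close> from the subgroup \<open>H\<close> generated by the \<open>t\<^sub>i\<close> to \<open>\<int>/N\<close> which sends
  every \<open>t\<^sub>i\<close> to \<open>L\<close> or \<open>N - L\<close>, and these two shifts move \<open>[0, L)\<close> off itself. It need not extend to a
  continuous character, but up to a set of small measure there is a Borel map \<open>\<phi>\<close> from the whole group
  with \<open>\<phi>(x + t\<^sub>i) = \<phi>(x) + \<psi>(t\<^sub>i)\<close>; preimages of translates of \<open>[0, L)\<close> then have average measure
  close to \<open>L/N\<close>. To build \<open>\<phi>\<close>, cover the group by finitely many open sets \<open>B\<close> whose points differ by no
  short nonzero element of \<open>H\<close>. Process them one after the other: around each point \<open>b \<in> B\<close> that is still
  free take the free part of \<open>b\<close> plus a box in \<open>H\<close>, and put \<open>\<phi>(b + h) = \<psi>(h)\<close> there. As boxes grow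
  polynomially, some radius makes the boundary of the new region small relative to its measure.
\<close>

section \<open>Integer multiples and integer combinations of the generators\<close>

lemma zsmul_0 [simp]: "zsmul 0 x = 0"
  by (simp add: zsmul_def)

text \<open>The sign split in the definition of \<open>zsmul\<close> is dealt with here; additivity
  then follows by induction on integers, upwards and downwards from 0.\<close>

lemma zsmul_add_1: "zsmul (k + 1) x = zsmul k x + x"
proof (cases "0 \<le> k")
  case True
  then have "nat (k + 1) = Suc (nat k)" by simp
  then show ?thesis using True by (simp add: zsmul_def add.commute)
next
  case False
  define n where "n = nat (- k - 1)"
  have k: "k = - int (Suc n)" using False by (simp add: n_def)
  have "nat (int n + 1) = Suc n" by simp
  then show ?thesis by (simp add: k zsmul_def)
qed

lemma zsmul_1 [simp]: "zsmul 1 x = x"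
  using zsmul_add_1[of 0 x] by simp

lemma zsmul_add: "zsmul (a + b) x = zsmul a x + zsmul b x"
proof (induction b rule: int_induct[where k = 0])
  case (step1 i)
  then show ?case using zsmul_add_1[of "a + i" x] zsmul_add_1[of i x] by (simp add: algebra_simps)
next
  case (step2 i)
  then show ?case using zsmul_add_1[of "a + (i - 1)" x] zsmul_add_1[of "i - 1" x]
    by (simp add: algebra_simps)
qed simp

lemma zsmul_minus: "zsmul (- a) x = - zsmul a x"
  using zsmul_add[of "- a" a x] by (simp add: eq_neg_iff_add_eq_0)

lemma zsmul_diff: "zsmul (a - b) x = zsmul a x - zsmul b x"
  using zsmul_add[of a "- b" x] by (simp add: zsmul_minus)

definition lincomb :: "nat \<Rightarrow> (nat \<Rightarrow> 'a::ab_group_add) \<Rightarrow> (nat \<Rightarrow> int) \<Rightarrow> 'a" where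
  "lincomb r t n = (\<Sum>i<r. zsmul (n i) (t i))"

lemma lincomb_diff: "lincomb r t (\<lambda>i. a i - b i) = lincomb r t a - lincomb r t b"
  by (simp add: lincomb_def zsmul_diff sum_subtractf)

lemma lincomb_add: "lincomb r t (\<lambda>i. a i + b i) = lincomb r t a + lincomb r t b"
  by (simp add: lincomb_def zsmul_add sum.distrib)

lemma lincomb_unit:
  assumes "i < r"
  shows "lincomb r t (\<lambda>j. of_bool (j = i)) = t i"
proof -
  have "lincomb r t (\<lambda>j. of_bool (j = i)) = (\<Sum>j<r. if j = i then t j else 0)"
    unfolding lincomb_def by (rule sum.cong) auto
  then show ?thesis using assms by simp
qed

section \<open>Boxes in the subgroup generated by the \<open>t i\<close>\<close>

text \<open>Coefficient vectors are taken extensional so that there are finitely many of them.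
  Relations between the \<open>t i\<close> may identify vectors, so counting gives an upper bound on
  the size of the image.\<close>

definition lattice_box :: "nat \<Rightarrow> (nat \<Rightarrow> 'a::ab_group_add) \<Rightarrow> nat \<Rightarrow> 'a set" where
  "lattice_box r t \<rho> = lincomb r t ` ({..<r} \<rightarrow>\<^sub>E {- int \<rho>..int \<rho>})"

lemma lincomb_in_lattice_box:
  assumes "\<And>i. i < r \<Longrightarrow> \<bar>n i\<bar> \<le> int \<rho>"
  shows "lincomb r t n \<in> lattice_box r t \<rho>"
proof -
  have "lincomb r t n = lincomb r t (restrict n {..<r})"
    unfolding lincomb_def by (rule sum.cong) auto
  moreover have "restrict n {..<r} \<in> {..<r} \<rightarrow>\<^sub>E {- int \<rho>..int \<rho>}"
  proof (rule PiE_I)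
    fix i assume "i \<in> {..<r}"
    then show "restrict n {..<r} i \<in> {- int \<rho>..int \<rho>}" using assms[of i] by auto
  qed simp
  ultimately show ?thesis unfolding lattice_box_def by blast
qed

lemma lattice_boxE:
  assumes "h \<in> lattice_box r t \<rho>"
  obtains n where "h = lincomb r t n" "\<And>i. i < r \<Longrightarrow> \<bar>n i\<bar> \<le> int \<rho>"
proof -
  obtain n where n: "h = lincomb r t n" "n \<in> {..<r} \<rightarrow>\<^sub>E {- int \<rho>..int \<rho>}"
    using assms unfolding lattice_box_def by blast
  have "\<bar>n i\<bar> \<le> int \<rho>" if "i < r" for i
    using PiE_mem[OF n(2), of i] that by auto
  then show thesis using that n(1) by blast
qed

lemma finite_lattice_box [simp]: "finite (lattice_box r t \<rho>)"
  unfolding lattice_box_def by (intro finite_imageI finite_PiE) auto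

lemma card_lattice_box_le: "card (lattice_box r t \<rho>) \<le> (2 * \<rho> + 1) ^ r"
proof -
  have "card (lattice_box r t \<rho>) \<le> card ({..<r} \<rightarrow>\<^sub>E {- int \<rho>..int \<rho>})"
    unfolding lattice_box_def by (intro card_image_le finite_PiE) auto
  also have "\<dots> = (2 * \<rho> + 1) ^ r"
    by (simp add: card_PiE nat_add_distrib nat_mult_distrib)
  finally show ?thesis .
qed

lemma lattice_box_0 [simp]: "lattice_box r t 0 = {0}"
proof -
  have "h = 0" if "h \<in> lattice_box r t 0" for h
    using that by (elim lattice_boxE) (auto simp: lincomb_def)
  moreover have "lincomb r t (\<lambda>_. 0) \<in> lattice_box r t 0" by (rule lincomb_in_lattice_box) simp
  ultimately show ?thesis by (auto simp: lincomb_def)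
qed

lemma lattice_box_diff:
  assumes "g \<in> lattice_box r t \<rho>" "h \<in> lattice_box r t \<sigma>"
  shows "g - h \<in> lattice_box r t (\<rho> + \<sigma>)"
proof -
  obtain a b where ab: "g = lincomb r t a" "\<And>i. i < r \<Longrightarrow> \<bar>a i\<bar> \<le> int \<rho>"
    "h = lincomb r t b" "\<And>i. i < r \<Longrightarrow> \<bar>b i\<bar> \<le> int \<sigma>"
    using assms by (metis lattice_boxE)
  have "\<bar>a i - b i\<bar> \<le> int (\<rho> + \<sigma>)" if "i < r" for i
    using ab(2,4)[OF that] by linarith
  then show ?thesis using lincomb_in_lattice_box[of r "\<lambda>i. a i - b i" "\<rho> + \<sigma>" t] ab(1,3) by (simp add: lincomb_diff)
qed

lemma zero_in_lattice_box: "0 \<in> lattice_box r t \<rho>"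
  using lincomb_in_lattice_box[of r "\<lambda>_. 0" \<rho> t] by (simp add: lincomb_def)

lemma uminus_lattice_box: "h \<in> lattice_box r t \<rho> \<Longrightarrow> - h \<in> lattice_box r t \<rho>"
  using lattice_box_diff[of 0 r t 0 h \<rho>] by simp

lemma lattice_box_add:
  assumes "g \<in> lattice_box r t \<rho>" "h \<in> lattice_box r t \<sigma>"
  shows "g + h \<in> lattice_box r t (\<rho> + \<sigma>)"
  using lattice_box_diff[OF assms(1) uminus_lattice_box[OF assms(2)]] by simp

lemma lattice_box_mono:
  assumes "\<rho> \<le> \<sigma>"
  shows "lattice_box r t \<rho> \<subseteq> lattice_box r t \<sigma>"
proof
  fix h assume "h \<in> lattice_box r t \<rho>"
  then show "h \<in> lattice_box r t \<sigma>"
    using lattice_box_add[of h r t \<rho> 0 "\<sigma> - \<rho>"] zero_in_lattice_box[of r t "\<sigma> - \<rho>"] assms by simp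
qed

lemma generator_in_lattice_box:
  assumes "i < r"
  shows "t i \<in> lattice_box r t 1"
  using lincomb_in_lattice_box[of r "\<lambda>j. of_bool (j = i)" 1 t] lincomb_unit[OF assms, of t] by simp

section \<open>Choice of a radius of slow growth\<close>

text \<open>Growth by more than the factor \<open>1 + \<epsilon>\<close> at each of the first
  \<open>R\<close> radii would give \<open>V R\<close> at least
  \<open>(1 + \<epsilon>) ^ R * V 0\<close>, which exceeds the bound \<open>K * V 0\<close>.\<close>

lemma slow_growth_radius:
  fixes V :: "nat \<Rightarrow> real"
  assumes "0 < \<epsilon>" "0 < R" "K < (1 + \<epsilon>) ^ R"
    and le: "\<And>n. V n \<le> real (k n) * V 0" and "real (k R) \<le> K" and nonneg: "\<And>n. 0 \<le> V n"
  obtains \<rho> where "\<rho> < R" "V (Suc \<rho>) \<le> (1 + \<epsilon>) * V \<rho>"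
proof -
  have "\<exists>\<rho><R. V (Suc \<rho>) \<le> (1 + \<epsilon>) * V \<rho>"
  proof (rule ccontr)
    assume "\<not> ?thesis"
    then have gr: "(1 + \<epsilon>) * V \<rho> < V (Suc \<rho>)" if "\<rho> < R" for \<rho>
      using that by (meson not_le)
    \<comment> \<open>If \<open>V 0\<close> vanished, the upper bound would force \<open>V 1\<close>
      to be at most 0, against strict growth from radius 0.\<close>
    have "V 0 \<noteq> 0"
      using gr[OF \<open>0 < R\<close>] le[of "Suc 0"] by auto
    then have pos: "V 0 > 0" using nonneg[of 0] by linarith
    have "(1 + \<epsilon>) ^ n * V 0 \<le> V n" if "n \<le> R" for n
      using that
    proof (induction n)
      case (Suc n)
      have "(1 + \<epsilon>) ^ Suc n * V 0 = (1 + \<epsilon>) * ((1 + \<epsilon>) ^ n * V 0)" by simp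
      also have "\<dots> \<le> (1 + \<epsilon>) * V n"
        using Suc \<open>0 < \<epsilon>\<close> by (intro mult_left_mono) auto
      finally show ?case using gr[of n] Suc.prems by simp
    qed simp
    from this[of R] have "(1 + \<epsilon>) ^ R * V 0 \<le> real (k R) * V 0" using le[of R] by simp
    then show False using pos assms(3,5) by simp
  qed
  then show thesis using that by blast
qed

lemma power_bounded_by_exponential:
  fixes \<epsilon> :: real
  assumes "0 < \<epsilon>"
  obtains R :: nat where "0 < R" "real ((2 * R + 1) ^ r) < (1 + \<epsilon>) ^ R"
proof -
  have "eventually (\<lambda>n::nat. real ((2 * n + 1) ^ r) < (1 + \<epsilon>) ^ n) sequentially"
    using assms by real_asymp
  then have "eventually (\<lambda>n::nat. 0 < n \<and> real ((2 * n + 1) ^ r) < (1 + \<epsilon>) ^ n) sequentially"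
    using eventually_gt_at_top[of 0] by eventually_elim auto
  then show thesis using that eventually_happens'[OF sequentially_bot] by blast
qed

section \<open>Translates of a set under an invariant probability measure\<close>

locale translation_invariant_prob = prob_space \<mu>
  for \<mu> :: "'a::{topological_ab_group_add, t2_space} measure" +
  assumes sets_eq [measurable_cong]: "sets \<mu> = sets borel"
    and emeasure_translate: "A \<in> sets borel \<Longrightarrow> emeasure \<mu> ((+) x ` A) = emeasure \<mu> A"
begin

lemma translate_borel [measurable]:
  assumes "A \<in> sets borel"
  shows "(+) (x::'a) ` A \<in> sets borel"
proof -
  have "continuous_on UNIV (\<lambda>y::'a. y - x)" by (intro continuous_intros)
  then have "(\<lambda>y. y - x) \<in> borel_measurable borel" by (rule borel_measurable_continuous_onI)
  from measurable_sets[OF this assms] have "(\<lambda>y. y - x) -` A \<in> sets borel" by simp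
  also have "(\<lambda>y. y - x) -` A = (+) x ` A"
  proof (intro equalityI subsetI)
    fix y assume "y \<in> (\<lambda>y. y - x) -` A"
    then have "x + (y - x) \<in> (+) x ` A" by blast
    then show "y \<in> (+) x ` A" by simp
  qed auto
  finally show ?thesis .
qed

lemma measure_translate: "A \<in> sets borel \<Longrightarrow> measure \<mu> ((+) x ` A) = measure \<mu> A"
  by (simp add: measure_def emeasure_translate)

lemma measure_Union_translates_le:
  assumes "finite H" "B \<in> sets borel"
  shows "measure \<mu> (\<Union>h\<in>H. (+) h ` B) \<le> real (card H) * measure \<mu> B"
proof -
  have "measure \<mu> (\<Union>h\<in>H. (+) h ` B) \<le> (\<Sum>h\<in>H. measure \<mu> ((+) h ` B))"
    using assms by (intro finite_measure_subadditive_finite) (auto simp: sets_eq translate_borel)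
  then show ?thesis using assms by (simp add: measure_translate)
qed

text \<open>Double counting: the integral of the number of indices \<open>j\<close> with
  \<open>y\<close> in the \<open>j\<close>-th translate is \<open>N * measure \<mu> A\<close>, while
  no \<open>y\<close> lies in two cyclically consecutive translates.\<close>

lemma measure_le_closed_walk:
  assumes A: "A \<in> sets borel" and N: "0 < N"
    and closed: "x N = x 0"
    and disj: "\<And>j. j < N \<Longrightarrow> (+) (x j) ` A \<inter> (+) (x (Suc j)) ` A = {}"
  shows "measure \<mu> A \<le> real (N div 2) / real N"
proof -
  have int: "integrable \<mu> (indicator ((+) (x j) ` A) :: 'a \<Rightarrow> real)" for j
    using A by (auto simp: sets_eq translate_borel less_top[symmetric])
  have pointwise: "(\<Sum>j<N. indicator ((+) (x j) ` A) y :: real) \<le> real (N div 2)" for y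
  proof -
    define f :: "nat \<Rightarrow> nat" where "f j = indicator ((+) (x j) ` A) y" for j
    have "f N = f 0" using closed by (simp add: f_def)
    \<comment> \<open>Closedness lets the sum be shifted by one index; each pair
      \<open>f j + f (Suc j)\<close> is at most 1, so twice the sum is at most
      \<open>N\<close>.\<close>
    have "2 * (\<Sum>j<N. f j) = (\<Sum>j<N. f j) + (\<Sum>j<N. f (Suc j))"
      using sum.lessThan_Suc_shift[of f N] \<open>f N = f 0\<close> by simp
    also have "\<dots> = (\<Sum>j<N. f j + f (Suc j))" by (simp add: sum.distrib)
    also have "\<dots> \<le> (\<Sum>j<N. 1)"
      using disj by (intro sum_mono) (auto simp: f_def indicator_def)
    finally have "(\<Sum>j<N. f j) \<le> N div 2" by simp
    then have "real (\<Sum>j<N. f j) \<le> real (N div 2)" by linarith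
    moreover have "real (f j) = indicator ((+) (x j) ` A) y" for j
      by (simp add: f_def indicator_def)
    ultimately show ?thesis by simp
  qed
  have "real N * measure \<mu> A = (\<Sum>j<N. measure \<mu> ((+) (x j) ` A))"
    using A by (simp add: measure_translate)
  also have "\<dots> = (\<integral>y. (\<Sum>j<N. indicator ((+) (x j) ` A) y) \<partial>\<mu>)"
    using int A by (simp add: Bochner_Integration.integral_sum sets_eq translate_borel)
  also have "\<dots> \<le> (\<integral>y. real (N div 2) \<partial>\<mu>)"
    using pointwise int by (intro integral_mono) auto
  also have "\<dots> = real (N div 2)" by (simp add: prob_space)
  finally show ?thesis using N by (simp add: field_simps)
qed

end

section \<open>Equivariant labellings up to a small exceptional set\<close>

text \<open>\<open>\<psi>\<close> is a homomorphism to the integers modulo \<open>N\<close>, defined only on the subgroup generated by the \<open>t i\<close>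
  and sending \<open>t i\<close> to \<open>\<theta> i\<close>.\<close>

locale labelled_generators = translation_invariant_prob \<mu>
  for \<mu> :: "'a::{topological_ab_group_add, t2_space} measure" +
  fixes r :: nat and t :: "nat \<Rightarrow> 'a" and N :: int and \<theta> :: "nat \<Rightarrow> int" and \<psi> :: "'a \<Rightarrow> int"
  assumes N_pos: "0 < N"
    and \<psi>_range: "\<psi> h \<in> {0..<N}"
    and \<psi>_add: "h \<in> lattice_box r t \<rho> \<Longrightarrow> i < r \<Longrightarrow> \<psi> (h + t i) = (\<psi> h + \<theta> i) mod N"
begin

abbreviation Bx :: "nat \<Rightarrow> 'a set" where "Bx \<equiv> lattice_box r t"

definition domain :: "(int \<Rightarrow> 'a set) \<Rightarrow> 'a set" where
  "domain E = (\<Union>s\<in>{0..<N}. E s)"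

text \<open>The sets \<open>E s\<close> are the level sets of a partial map to the integers modulo \<open>N\<close>. Outside the exceptional
  set \<open>Z\<close> this map is equivariant and no step \<open>x \<mapsto> x + t i\<close> crosses the boundary of its domain.\<close>

definition partial_labelling :: "real \<Rightarrow> (int \<Rightarrow> 'a set) \<Rightarrow> 'a set \<Rightarrow> bool" where
  "partial_labelling \<delta> E Z \<longleftrightarrow>
     (\<forall>s. E s \<in> sets borel) \<and> Z \<in> sets borel \<and> disjoint_family_on E {0..<N} \<and>
     measure \<mu> Z \<le> \<delta> * measure \<mu> (domain E) \<and>
     (\<forall>s\<in>{0..<N}. \<forall>x\<in>E s - Z. \<forall>i<r. x + t i \<in> E ((s + \<theta> i) mod N)) \<and>
     (\<forall>x. \<forall>i<r. x + t i \<in> domain E \<longrightarrow> x \<notin> domain E \<longrightarrow> x \<in> Z)"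

lemma partial_labelling_step:
  "partial_labelling \<delta> E Z \<Longrightarrow> s \<in> {0..<N} \<Longrightarrow> x \<in> E s \<Longrightarrow> x \<notin> Z \<Longrightarrow> i < r \<Longrightarrow> x + t i \<in> E ((s + \<theta> i) mod N)"
  unfolding partial_labelling_def by blast

lemma partial_labelling_boundary:
  "partial_labelling \<delta> E Z \<Longrightarrow> i < r \<Longrightarrow> x + t i \<in> domain E \<Longrightarrow> x \<notin> domain E \<Longrightarrow> x \<in> Z"
  unfolding partial_labelling_def by blast

lemma partial_labelling_unique:
  "partial_labelling \<delta> E Z \<Longrightarrow> x \<in> E s \<Longrightarrow> x \<in> E s' \<Longrightarrow> s \<in> {0..<N} \<Longrightarrow> s' \<in> {0..<N} \<Longrightarrow> s = s'"
  unfolding partial_labelling_def disjoint_family_on_def by blast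

lemma domain_borel: "(\<And>s. E s \<in> sets borel) \<Longrightarrow> domain E \<in> sets borel"
  unfolding domain_def by (intro sets.countable_UN'') auto

text \<open>Slow growth yields a radius \<open>\<rho>\<close> at which the outer layer
  \<open>Q\<close> has measure at most \<open>\<epsilon>\<close> times that of the new region
  \<open>D\<close>. The layer and its \<open>r\<close> translates by \<open>- t i\<close> join the
  exceptional set, whence the factor \<open>1 + r\<close>. The separation radius
  \<open>2 * R + 1\<close> leaves room for two boxes of radius \<open>\<rho>\<close> and one step
  between them.\<close>

lemma carve_cluster:
  assumes P: "partial_labelling ((1 + real r) * \<epsilon>) E Z"
    and B: "B \<in> sets borel"
    and sep: "\<And>b b'. b \<in> B \<Longrightarrow> b' \<in> B \<Longrightarrow> b - b' \<in> Bx (2 * R + 1) \<Longrightarrow> b = b'"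
    and \<epsilon>: "0 < \<epsilon>" and R: "0 < R" "real ((2 * R + 1) ^ r) < (1 + \<epsilon>) ^ R"
  obtains E' Z' where "partial_labelling ((1 + real r) * \<epsilon>) E' Z'" "domain E \<union> B \<subseteq> domain E'"
proof -
  define C where "C = domain E"
  have E_borel: "E s \<in> sets borel" for s using P by (simp add: partial_labelling_def)
  have C_borel: "C \<in> sets borel" unfolding C_def using E_borel by (rule domain_borel)
  have Z_borel: "Z \<in> sets borel" using P by (simp add: partial_labelling_def)
  define B' where "B' = B - C"
  have B'_borel: "B' \<in> sets borel" using B C_borel by (simp add: B'_def)
  define W where "W n = (\<Union>h\<in>Bx n. (+) h ` B') - C" for n
  have W_borel: "W n \<in> sets borel" for n
    unfolding W_def using C_borel B'_borel
    by (intro sets.Diff sets.finite_UN finite_lattice_box translate_borel) auto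
  have W_I: "h + b \<in> W n" if "h \<in> Bx n" "b \<in> B'" "h + b \<notin> C" for h b n
    using that by (auto simp: W_def)
  have W_mono: "W n \<subseteq> W (Suc n)" for n
    using lattice_box_mono[of n "Suc n" r t] by (auto simp: W_def)
  have W0: "W 0 = B'" by (auto simp: W_def B'_def)
  obtain \<rho> where \<rho>: "\<rho> < R" "measure \<mu> (W (Suc \<rho>)) \<le> (1 + \<epsilon>) * measure \<mu> (W \<rho>)"
  proof (rule slow_growth_radius[of \<epsilon> R _ "\<lambda>n. measure \<mu> (W n)" "\<lambda>n. card (Bx n)"])
    fix n
    have "measure \<mu> (W n) \<le> measure \<mu> (\<Union>h\<in>Bx n. (+) h ` B')"
      using B'_borel by (intro finite_measure_mono) (auto simp: W_def sets_eq translate_borel intro!: sets.finite_UN)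
    also have "\<dots> \<le> real (card (Bx n)) * measure \<mu> B'"
      using B'_borel by (intro measure_Union_translates_le) auto
    finally show "measure \<mu> (W n) \<le> real (card (Bx n)) * measure \<mu> (W 0)" by (simp add: W0)
  next
    show "real (card (Bx R)) \<le> real ((2 * R + 1) ^ r)"
      using card_lattice_box_le[of r t R] by linarith
  qed (use \<epsilon> R in auto)
  define D where "D = W \<rho>"
  define Q where "Q = W (Suc \<rho>) - D"
  have D_borel: "D \<in> sets borel" and Q_borel: "Q \<in> sets borel"
    using W_borel by (auto simp: D_def Q_def)
  have "measure \<mu> Q = measure \<mu> (W (Suc \<rho>)) - measure \<mu> D"
    unfolding Q_def D_def using W_borel W_mono by (intro finite_measure_Diff) (auto simp: sets_eq)
  then have Q_le: "measure \<mu> Q \<le> \<epsilon> * measure \<mu> D"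
    using \<rho>(2) by (simp add: D_def algebra_simps)
  define F where "F s = (\<Union>h\<in>{h \<in> Bx \<rho>. \<psi> h = s}. (+) h ` B') - C" for s
  have F_borel: "F s \<in> sets borel" for s
    unfolding F_def using C_borel B'_borel
    by (intro sets.Diff sets.finite_UN translate_borel) auto
  have F_Union: "(\<Union>s\<in>{0..<N}. F s) = D"
  proof
    show "(\<Union>s\<in>{0..<N}. F s) \<subseteq> D" by (auto simp: F_def D_def W_def)
    show "D \<subseteq> (\<Union>s\<in>{0..<N}. F s)"
    proof
      fix x assume "x \<in> D"
      then obtain h where "h \<in> Bx \<rho>" "x \<in> (+) h ` B'" "x \<notin> C" unfolding D_def W_def by blast
      then have "x \<in> F (\<psi> h)" unfolding F_def by blast
      then show "x \<in> (\<Union>s\<in>{0..<N}. F s)" using \<psi>_range by blast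
    qed
  qed
  have F_C: "F s \<inter> C = {}" for s by (auto simp: F_def)
  have D_C: "D \<inter> C = {}" by (auto simp: D_def W_def)
  define E' where "E' s = E s \<union> F s" for s
  \<comment> \<open>\<open>Q\<close> catches the starting points of steps that enter
    \<open>D\<close> from outside the new domain; its translates by \<open>- t i\<close> catch those
    of steps that leave \<open>D\<close> for the layer.\<close>
  define Z' where "Z' = Z \<union> Q \<union> (\<Union>i<r. (+) (- t i) ` Q)"
  have dom: "domain E' = C \<union> D"
    unfolding domain_def E'_def UN_Un_distrib F_Union by (simp add: C_def domain_def)
  text \<open>Both endpoints of a step inside the new region belong to the same translate of the box.\<close>
  have same_centre: "b = b'"
    if "h + b + k = h' + b'" "h \<in> Bx \<rho>" "h' \<in> Bx \<rho>" "b \<in> B'" "b' \<in> B'" "k \<in> Bx 1" for h b k h' b'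
  proof -
    have "b - b' = h' - h - k" using that(1) by (simp add: algebra_simps)
    also have "\<dots> \<in> Bx (\<rho> + \<rho> + 1)"
      using that by (intro lattice_box_diff)
    also have "\<dots> \<subseteq> Bx (2 * R + 1)" using \<rho>(1) by (intro lattice_box_mono) simp
    finally show ?thesis using sep that by (auto simp: B'_def)
  qed
  have "partial_labelling ((1 + real r) * \<epsilon>) E' Z'"
    unfolding partial_labelling_def
  proof (intro conjI allI ballI impI)
    show "E' s \<in> sets borel" for s using E_borel F_borel by (simp add: E'_def)
    show "Z' \<in> sets borel" unfolding Z'_def using Z_borel Q_borel
      by (intro sets.Un sets.finite_UN translate_borel) auto
    show "disjoint_family_on E' {0..<N}"
      unfolding disjoint_family_on_def
    proof (intro ballI impI)
      fix s s' assume s: "s \<in> {0..<N}" "s' \<in> {0..<N}" "s \<noteq> s'"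
      have "E s \<inter> E s' = {}"
        using partial_labelling_unique[OF P] s by blast
      moreover have "E s \<subseteq> C" "E s' \<subseteq> C" using s by (auto simp: C_def domain_def)
      moreover have "F s \<inter> F s' = {}"
      proof (rule ccontr)
        assume "F s \<inter> F s' \<noteq> {}"
        then obtain h b h' b' where *: "h + b = h' + b'" "h \<in> Bx \<rho>" "h' \<in> Bx \<rho>"
          "b \<in> B'" "b' \<in> B'" "\<psi> h = s" "\<psi> h' = s'"
          unfolding F_def by blast
        \<comment> \<open>The case of a step of length 0: a point of \<open>D\<close> has only one
          centre, hence only one label.\<close>
        then have "b = b'" using same_centre[of h b 0 h' b'] by (simp add: zero_in_lattice_box)
        then show False using * s(3) by simp
      qed
      ultimately show "E' s \<inter> E' s' = {}" using F_C[of s] F_C[of s'] by (auto simp: E'_def)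
    qed
    have translates_borel: "(\<Union>i<r. (+) (- t i) ` Q) \<in> sets borel"
      using Q_borel by (intro sets.finite_UN translate_borel) auto
    have "measure \<mu> Z' \<le> measure \<mu> (Z \<union> Q) + measure \<mu> (\<Union>i<r. (+) (- t i) ` Q)"
      unfolding Z'_def using Z_borel Q_borel translates_borel
      by (intro measure_Un_le) (simp_all only: sets_eq sets.Un)
    also have "measure \<mu> (Z \<union> Q) \<le> measure \<mu> Z + measure \<mu> Q"
      using Z_borel Q_borel by (intro measure_Un_le) (auto simp: sets_eq)
    also have "measure \<mu> (\<Union>i<r. (+) (- t i) ` Q) \<le> (\<Sum>i<r. measure \<mu> ((+) (- t i) ` Q))"
      using Q_borel by (intro finite_measure_subadditive_finite image_subsetI finite_lessThan)
        (simp only: sets_eq translate_borel)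
    also have "\<dots> = real r * measure \<mu> Q" using Q_borel by (simp only: measure_translate sum_constant card_lessThan)
    also have "measure \<mu> Z + measure \<mu> Q + real r * measure \<mu> Q
        = measure \<mu> Z + (1 + real r) * measure \<mu> Q" by (simp add: algebra_simps)
    also have "\<dots> \<le> (1 + real r) * \<epsilon> * measure \<mu> C + (1 + real r) * (\<epsilon> * measure \<mu> D)"
      using P Q_le by (intro add_mono mult_left_mono) (auto simp: partial_labelling_def C_def)
    also have "\<dots> = (1 + real r) * \<epsilon> * measure \<mu> (domain E')"
      unfolding dom using C_borel D_borel D_C
      by (subst finite_measure_Union) (auto simp: sets_eq algebra_simps)
    finally show "measure \<mu> Z' \<le> (1 + real r) * \<epsilon> * measure \<mu> (domain E')" by simp
  next
    fix s x i assume s: "s \<in> {0..<N}" and x: "x \<in> E' s - Z'" and i: "i < r"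
    show "x + t i \<in> E' ((s + \<theta> i) mod N)"
    proof (cases "x \<in> E s")
      case True
      then show ?thesis using partial_labelling_step[OF P s True _ i] x by (simp add: E'_def Z'_def)
    next
      case False
      then have "x \<in> F s" using x by (auto simp: E'_def)
      then obtain h b where hb: "x = h + b" "h \<in> Bx \<rho>" "\<psi> h = s" "b \<in> B'" "x \<notin> C"
        by (auto simp: F_def)
      \<comment> \<open>A step from outside the old domain into it would start in the old
        exceptional set.\<close>
      have C': "x + t i \<notin> C"
        using partial_labelling_boundary[OF P i] hb(5) x by (auto simp: C_def Z'_def)
      have ht: "h + t i \<in> Bx (Suc \<rho>)"
        using lattice_box_add[OF hb(2) generator_in_lattice_box[of i r t, OF i]] by simp
      have "x + t i = (h + t i) + b" using hb(1) by (simp add: algebra_simps)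
      then have "x + t i \<in> W (Suc \<rho>)" using W_I[OF ht hb(4)] C' by metis
      moreover have "x + t i \<notin> Q"
      proof
        assume "x + t i \<in> Q"
        then have "- t i + (x + t i) \<in> (+) (- t i) ` Q" by (rule imageI)
        then have "x \<in> (+) (- t i) ` Q" by simp
        then have "x \<in> Z'" unfolding Z'_def using i by blast
        then show False using x by blast
      qed
      ultimately have "x + t i \<in> D" by (simp add: Q_def)
      then obtain h' b' where hb': "x + t i = h' + b'" "h' \<in> Bx \<rho>" "b' \<in> B'"
        by (auto simp: D_def W_def)
      have step: "h + b + t i = h' + b'" using hb(1) hb'(1) by simp
      have "b = b'"
        by (rule same_centre[OF step hb(2) hb'(2) hb(4) hb'(3) generator_in_lattice_box[OF i]])
      then have "h' + b = (h + t i) + b" using step by (simp add: ac_simps)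
      then have "h' = h + t i" by simp
      then have "\<psi> h' = (s + \<theta> i) mod N" using \<psi>_add[OF hb(2) i] hb(3) by simp
      then have "x + t i \<in> F ((s + \<theta> i) mod N)" unfolding F_def using hb' C' by blast
      then show ?thesis by (simp add: E'_def)
    qed
  next
    fix x i assume i: "i < r" and x: "x + t i \<in> domain E'" "x \<notin> domain E'"
    show "x \<in> Z'"
    proof (cases "x + t i \<in> C")
      case True
      then show ?thesis
        using partial_labelling_boundary[OF P i, of x] x by (simp add: Z'_def dom C_def)
    next
      case False
      then have "x + t i \<in> D" using x by (simp add: dom)
      then obtain h b where hb: "x + t i = h + b" "h \<in> Bx \<rho>" "b \<in> B'" by (auto simp: D_def W_def)
      have "h - t i \<in> Bx (Suc \<rho>)"
        using lattice_box_diff[OF hb(2) generator_in_lattice_box[of i r t, OF i]] by simp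
      moreover have "x = (h - t i) + b" using hb(1) by (simp add: algebra_simps)
      moreover have "x \<notin> C" using x(2) by (simp add: dom)
      ultimately have "x \<in> W (Suc \<rho>)" using W_I[of "h - t i" "Suc \<rho>" b] hb(3) by metis
      then show ?thesis using x by (simp add: Z'_def Q_def dom)
    qed
  qed
  moreover have "domain E \<union> B \<subseteq> domain E'"
  proof -
    have "W 0 \<subseteq> D" using lattice_box_mono[of 0 \<rho> r t] unfolding D_def W_def by blast
    then show ?thesis unfolding dom C_def[symmetric] using W0 by (auto simp: B'_def)
  qed
  ultimately show thesis using that by blast
qed

text \<open>The finite set \<open>F - {0}\<close> is closed and misses \<open>0 - 0\<close>, so by
  continuity of subtraction some neighbourhood of 0 has no difference in it. All translates of this
  neighbourhood inherit the property, and finitely many of them cover the group.\<close>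

lemma separated_cover:
  assumes "compact (UNIV :: 'a set)" "finite (F :: 'a set)"
  obtains \<B> where "finite \<B>" "\<Union>\<B> = UNIV" "\<And>B. B \<in> \<B> \<Longrightarrow> open B"
    "\<And>B b b'. B \<in> \<B> \<Longrightarrow> b \<in> B \<Longrightarrow> b' \<in> B \<Longrightarrow> b - b' \<in> F \<Longrightarrow> b = b'"
proof -
  have "continuous_on UNIV (\<lambda>p::'a \<times> 'a. fst p - snd p)" by (intro continuous_intros)
  moreover have "open (- (F - {0}))"
    using assms(2) by (intro open_Compl finite_imp_closed) auto
  ultimately have "open ((\<lambda>p. fst p - snd p) -` (- (F - {0})))"
    using open_vimage by blast
  moreover have "(0, 0) \<in> (\<lambda>p. fst p - snd p) -` (- (F - {0}))" by simp
  ultimately obtain U V where UV: "open U" "open V" "0 \<in> U" "0 \<in> V"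
    "U \<times> V \<subseteq> (\<lambda>p. fst p - snd p) -` (- (F - {0}))"
    by (rule open_prod_elim) (auto simp: mem_Times_iff)
  define T where "T x = (\<lambda>y. y - x) -` (U \<inter> V)" for x :: 'a
  have T_open: "open (T x)" for x
    unfolding T_def using UV by (intro open_vimage) (auto intro!: continuous_intros)
  have "x \<in> T x" for x using UV by (simp add: T_def)
  then have "UNIV \<subseteq> \<Union> (range T)" by blast
  then obtain \<B> where \<B>: "\<B> \<subseteq> range T" "finite \<B>" "UNIV \<subseteq> \<Union>\<B>"
    using compactE[OF assms(1)] T_open by (metis (no_types, lifting) imageE)
  show thesis
  proof (rule that[OF \<B>(2)])
    show "\<Union>\<B> = UNIV" using \<B>(3) by blast
    show "open B" if "B \<in> \<B>" for B using that \<B>(1) T_open by blast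
    fix B b b' assume "B \<in> \<B>" and b: "b \<in> B" "b' \<in> B" "b - b' \<in> F"
    then obtain x where "B = T x" using \<B>(1) by blast
    then have "(b - x, b' - x) \<in> U \<times> V" using b by (simp add: T_def)
    then have "(b - x) - (b' - x) \<in> - (F - {0})" using UV(5) by fastforce
    then show "b = b'" using b(3) by simp
  qed
qed

text \<open>The members of a separated cover are carved one by one. As the exceptional set is
  bounded relative to the measure of the domain, the error does not depend on how many members there
  are.\<close>

lemma total_labelling:
  assumes "compact (UNIV :: 'a set)" "0 < \<delta>"
  obtains E Z where "partial_labelling \<delta> E Z" "domain E = UNIV"
proof -
  define \<epsilon> where "\<epsilon> = \<delta> / (1 + real r)"
  have \<epsilon>: "0 < \<epsilon>" "(1 + real r) * \<epsilon> = \<delta>" using assms(2) by (auto simp: \<epsilon>_def)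
  obtain R where R: "0 < R" "real ((2 * R + 1) ^ r) < (1 + \<epsilon>) ^ R"
    using power_bounded_by_exponential[OF \<epsilon>(1)] .
  obtain \<B> where \<B>: "finite \<B>" "\<Union>\<B> = UNIV" "\<And>B. B \<in> \<B> \<Longrightarrow> open B"
    "\<And>B b b'. B \<in> \<B> \<Longrightarrow> b \<in> B \<Longrightarrow> b' \<in> B \<Longrightarrow> b - b' \<in> Bx (2 * R + 1) \<Longrightarrow> b = b'"
    using separated_cover[OF assms(1) finite_lattice_box] by metis
  have "\<exists>E Z. partial_labelling \<delta> E Z \<and> \<Union>\<C> \<subseteq> domain E" if "finite \<C>" "\<C> \<subseteq> \<B>" for \<C>
    using that
  proof (induction \<C> rule: finite_induct)
    case empty
    have "partial_labelling \<delta> (\<lambda>_. {}) {}"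
      by (simp add: partial_labelling_def domain_def disjoint_family_on_def)
    then show ?case by blast
  next
    case (insert B \<C>)
    then obtain E Z where EZ: "partial_labelling \<delta> E Z" "\<Union>\<C> \<subseteq> domain E" by blast
    obtain E' Z' where "partial_labelling \<delta> E' Z'" "domain E \<union> B \<subseteq> domain E'"
      using carve_cluster[of \<epsilon> E Z B R] EZ(1) \<epsilon> R \<B>(3,4)[of B] insert.prems by auto
    then show ?case using EZ(2) by (intro exI[of _ E'] exI[of _ Z']) auto
  qed
  from this[OF \<B>(1) order_refl] show thesis using that \<B>(2) by (metis top.extremum_uniqueI)
qed

text \<open>By \<open>jump\<close>, each shift \<open>\<theta> i\<close> carries the interval from 0
  to \<open>L\<close> off itself modulo \<open>N\<close>, so the preimages of its rotations are
  admissible once \<open>Z\<close> is removed. One of the \<open>N\<close> rotations reaches the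
  average measure.\<close>

lemma exists_admissible_set:
  assumes "compact (UNIV :: 'a set)" "0 < \<delta>"
    and L: "0 \<le> L" "L \<le> N"
    and jump: "\<And>i a. i < r \<Longrightarrow> 0 \<le> a \<Longrightarrow> a < L \<Longrightarrow> L \<le> a + \<theta> i \<and> a + \<theta> i < N"
  obtains A where "A \<in> sets borel" "{a - b | a b. a \<in> A \<and> b \<in> A} \<inter> t ` {..<r} = {}"
    "real_of_int L / real_of_int N * (1 - \<delta>) \<le> measure \<mu> A"
proof -
  obtain E Z where P: "partial_labelling \<delta> E Z" and dom: "domain E = UNIV"
    using total_labelling[OF assms(1,2)] .
  have E_borel: "E s \<in> sets borel" and Z_borel: "Z \<in> sets borel" for s
    using P by (auto simp: partial_labelling_def)
  have disj: "s = s'" if "x \<in> E s" "x \<in> E s'" "s \<in> {0..<N}" "s' \<in> {0..<N}" for x s s'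
    using partial_labelling_unique[OF P] that by blast
  define A where "A u = (\<Union>a\<in>{0..<L}. E ((a + u) mod N)) - Z" for u
  have A_borel: "A u \<in> sets borel" for u
    unfolding A_def using E_borel Z_borel by (intro sets.Diff sets.finite_UN) auto
  have A_admissible: "{a - b | a b. a \<in> A u \<and> b \<in> A u} \<inter> t ` {..<r} = {}" for u
  proof (rule ccontr)
    assume "\<not> ?thesis"
    then obtain x y i where xy: "y \<in> A u" "x \<in> A u" "y - x = t i" "i < r" by blast
    then obtain a a' where a: "a \<in> {0..<L}" "x \<in> E ((a + u) mod N)" "x \<notin> Z"
      and a': "a' \<in> {0..<L}" "y \<in> E ((a' + u) mod N)" by (auto simp: A_def)
    have "(a + u) mod N \<in> {0..<N}" using N_pos by simp
    then have "x + t i \<in> E (((a + u) mod N + \<theta> i) mod N)"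
      using partial_labelling_step[OF P] a xy(4) by blast
    moreover have "x + t i = y" using xy(3) by (simp add: algebra_simps)
    ultimately have "((a + u) mod N + \<theta> i) mod N = (a' + u) mod N"
      using disj[OF _ a'(2)] N_pos by simp
    then have "(a + u + \<theta> i) mod N = (a' + u) mod N" by (simp add: mod_add_left_eq)
    then have "N dvd (a + u + \<theta> i) - (a' + u)" by (simp add: mod_eq_dvd_iff)
    then have "N dvd a + \<theta> i - a'" by (simp add: algebra_simps)
    \<comment> \<open>Here \<open>a + \<theta> i\<close> is at least \<open>L\<close>, above
      \<open>a'\<close>, and stays below \<open>N\<close>, so the difference cannot be a multiple of
      \<open>N\<close>.\<close>
    moreover have "0 < a + \<theta> i - a'" "a + \<theta> i - a' < N"
      using jump[OF xy(4), of a] a(1) a'(1) by auto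
    ultimately show False using zdvd_not_zless by blast
  qed
  have A_measure: "measure \<mu> (A u) = (\<Sum>a\<in>{0..<L}. measure \<mu> (E ((a + u) mod N) - Z))" for u
  proof -
    have "A u = (\<Union>a\<in>{0..<L}. E ((a + u) mod N) - Z)" by (auto simp: A_def)
    moreover have "disjoint_family_on (\<lambda>a. E ((a + u) mod N) - Z) {0..<L}"
      unfolding disjoint_family_on_def
    proof (intro ballI impI, rule ccontr)
      fix a a' assume a: "a \<in> {0..<L}" "a' \<in> {0..<L}" "a \<noteq> a'"
        and "(E ((a + u) mod N) - Z) \<inter> (E ((a' + u) mod N) - Z) \<noteq> {}"
      then have "(a + u) mod N = (a' + u) mod N" using disj N_pos by fastforce
      then have "a mod N = a' mod N" by (simp add: mod_eq_dvd_iff)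
      then show False using a L(2) by simp
    qed
    ultimately show ?thesis
      using E_borel Z_borel by (simp only:) (rule finite_measure_finite_Union, auto simp: sets_eq)
  qed
  \<comment> \<open>For fixed \<open>a\<close>, the residue of \<open>a + u\<close> runs once
    through all labels as \<open>u\<close> does; summed over \<open>u\<close>, each \<open>a\<close>
    therefore contributes the measure of the whole complement of \<open>Z\<close>.\<close>
  have rotate: "(\<Sum>u\<in>{0..<N}. f ((a + u) mod N)) = (\<Sum>s\<in>{0..<N}. f s)" for f :: "int \<Rightarrow> real" and a
  proof (rule sum.reindex_bij_witness[of _ "\<lambda>s. (s - a) mod N" "\<lambda>u. (a + u) mod N"])
    fix u assume "u \<in> {0..<N}"
    then show "((a + u) mod N - a) mod N = u" by (simp add: mod_diff_left_eq)
    show "(a + u) mod N \<in> {0..<N}" using N_pos by simp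
  next
    fix s assume "s \<in> {0..<N}"
    then show "(a + (s - a) mod N) mod N = s" by (simp add: mod_add_right_eq)
    show "(s - a) mod N \<in> {0..<N}" using N_pos by simp
  qed simp
  have "(\<Sum>u\<in>{0..<N}. measure \<mu> (A u))
      = (\<Sum>a\<in>{0..<L}. \<Sum>u\<in>{0..<N}. measure \<mu> (E ((a + u) mod N) - Z))"
    unfolding A_measure by (rule sum.swap)
  also have "\<dots> = (\<Sum>a\<in>{0..<L}. \<Sum>s\<in>{0..<N}. measure \<mu> (E s - Z))"
    by (intro sum.cong refl rotate)
  also have "(\<Sum>s\<in>{0..<N}. measure \<mu> (E s - Z)) = measure \<mu> (\<Union>s\<in>{0..<N}. E s - Z)"
    using E_borel Z_borel disj
    by (intro finite_measure_finite_Union[symmetric])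
      (auto simp: sets_eq disjoint_family_on_def)
  also have "(\<Union>s\<in>{0..<N}. E s - Z) = UNIV - Z" using dom by (simp add: domain_def UN_extend_simps)
  also have "measure \<mu> (UNIV - Z) = 1 - measure \<mu> Z"
    using Z_borel prob_compl[of Z] sets_eq_imp_space_eq[OF sets_eq] by (simp add: sets_eq)
  finally have total: "(\<Sum>u\<in>{0..<N}. measure \<mu> (A u)) = real_of_int L * (1 - measure \<mu> Z)"
    using L by simp
  have "measure \<mu> Z \<le> \<delta> * measure \<mu> (domain E)" using P by (simp add: partial_labelling_def)
  also have "\<dots> \<le> \<delta>" using assms(2) by (simp add: mult_left_le)
  finally have Z_le: "measure \<mu> Z \<le> \<delta>" .
  have "\<exists>u\<in>{0..<N}. real_of_int L / real_of_int N * (1 - \<delta>) \<le> measure \<mu> (A u)"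
  proof (rule ccontr)
    assume "\<not> ?thesis"
    then have "(\<Sum>u\<in>{0..<N}. measure \<mu> (A u)) < (\<Sum>u\<in>{0..<N}. real_of_int L / real_of_int N * (1 - \<delta>))"
      using N_pos by (intro sum_strict_mono) (auto simp: not_le)
    also have "\<dots> = real_of_int L * (1 - \<delta>)" using N_pos by simp
    also have "\<dots> \<le> real_of_int L * (1 - measure \<mu> Z)"
      using Z_le L by (intro mult_left_mono) auto
    finally show False using total by simp
  qed
  then show thesis using that[OF A_borel A_admissible] by (elim bexE)
qed

end

section \<open>The upper bound from the relation \<open>m\<close>\<close>

text \<open>The walk uses up one generator after the other, taking \<open>\<bar>n i\<bar>\<close>
  steps along \<open>t i\<close> in the direction given by the sign of \<open>n i\<close>.\<close>

lemma lincomb_walk: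
  fixes t :: "nat \<Rightarrow> 'a::ab_group_add"
  shows "\<exists>x. x 0 = 0 \<and> x (nat (\<Sum>i<r. \<bar>n i\<bar>)) = lincomb r t n \<and>
    (\<forall>j<nat (\<Sum>i<r. \<bar>n i\<bar>). \<exists>i<r. x (Suc j) = x j + t i \<or> x (Suc j) = x j - t i)"
proof (induction r)
  case 0
  show ?case by (intro exI[of _ "\<lambda>_. 0"]) (simp add: lincomb_def)
next
  case (Suc r)
  define K where "K = nat (\<Sum>i<r. \<bar>n i\<bar>)"
  obtain x where x: "x 0 = 0" "x K = lincomb r t n"
    "\<And>j. j < K \<Longrightarrow> \<exists>i<r. x (Suc j) = x j + t i \<or> x (Suc j) = x j - t i"
    using Suc unfolding K_def by blast
  \<comment> \<open>At \<open>j = K\<close> both branches give \<open>x K\<close>, so the last leg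
    attaches to the walk from the induction hypothesis.\<close>
  define y where "y j = (if j \<le> K then x j else x K + zsmul (sgn (n r) * int (j - K)) (t r))" for j
  have y_K: "y (K + j) = x K + zsmul (sgn (n r) * int j) (t r)" for j
    by (simp add: y_def)
  have len: "nat (\<Sum>i<Suc r. \<bar>n i\<bar>) = K + nat \<bar>n r\<bar>"
    by (simp add: K_def nat_add_distrib sum_nonneg)
  have "\<exists>i<Suc r. y (Suc j) = y j + t i \<or> y (Suc j) = y j - t i" if "j < K + nat \<bar>n r\<bar>" for j
  proof (cases "j < K")
    case True
    then show ?thesis using x(3)[of j] by (auto simp: y_def intro: less_SucI)
  next
    case False
    then obtain l where l: "j = K + l" by (metis le_Suc_ex not_less)
    then have "n r \<noteq> 0" using that by auto
    then have "sgn (n r) = 1 \<or> sgn (n r) = - 1" by (simp add: sgn_if)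
    moreover have "y (Suc j) = y j + zsmul (sgn (n r)) (t r)"
      using y_K[of l] y_K[of "Suc l"] by (simp add: l zsmul_add distrib_left add.assoc add.commute)
    ultimately show ?thesis by (auto simp: zsmul_minus)
  qed
  moreover have "y 0 = 0" using x by (simp add: y_def)
  moreover have "y (K + nat \<bar>n r\<bar>) = lincomb (Suc r) t n"
    using y_K[of "nat \<bar>n r\<bar>"] x(2) by (simp add: lincomb_def sgn_mult_abs)
  ultimately show ?case unfolding len by blast
qed

text \<open>The walk spelled out by \<open>m\<close> returns to 0. A common point of two consecutive
  translates of \<open>A\<close> would make some \<open>t i\<close> a difference of two elements of
  \<open>A\<close>.\<close>

lemma (in translation_invariant_prob) admissible_measure_le:
  assumes A: "A \<in> sets borel" "{a - b | a b. a \<in> A \<and> b \<in> A} \<inter> t ` {..<r} = {}"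
    and rel: "lincomb r t m = 0" and pos: "0 < (\<Sum>i<r. \<bar>m i\<bar>)"
  shows "measure \<mu> A \<le> real_of_int ((\<Sum>i<r. \<bar>m i\<bar>) div 2) / real_of_int (\<Sum>i<r. \<bar>m i\<bar>)"
proof -
  define K where "K = nat (\<Sum>i<r. \<bar>m i\<bar>)"
  have K: "(\<Sum>i<r. \<bar>m i\<bar>) = int K" "0 < K" using pos by (auto simp: K_def)
  obtain x where x: "x 0 = 0" "x K = 0"
    "\<And>j. j < K \<Longrightarrow> \<exists>i<r. x (Suc j) = x j + t i \<or> x (Suc j) = x j - t i"
    using lincomb_walk[where r = r and n = m and t = t] rel unfolding K_def by metis
  have no_diff: "a - b \<noteq> t i" if "a \<in> A" "b \<in> A" "i < r" for a b i
    using A(2) that by blast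
  have "measure \<mu> A \<le> real (K div 2) / real K"
  proof (rule measure_le_closed_walk[OF A(1) K(2)])
    show "x K = x 0" using x by simp
    fix j assume "j < K"
    then obtain i where i: "i < r" "x (Suc j) = x j + t i \<or> x (Suc j) = x j - t i" using x(3) by blast
    show "(+) (x j) ` A \<inter> (+) (x (Suc j)) ` A = {}"
    proof (rule ccontr)
      assume "\<not> ?thesis"
      then obtain a b where ab: "a \<in> A" "b \<in> A" "x j + a = x (Suc j) + b" by blast
      then have "x j + a = x j + (t i + b) \<or> x j + a = x j + (b - t i)"
        using i(2) by (auto simp: algebra_simps)
      then have "a - b = t i \<or> b - a = t i" by (auto simp: algebra_simps)
      then show False using no_diff ab i(1) by blast
    qed
  qed
  moreover have "int K div 2 = int (K div 2)" by (simp add: zdiv_int)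
  ultimately show ?thesis unfolding K(1) by simp
qed

section \<open>Labels modulo \<open>N\<close> compatible with the relation\<close>

text \<open>For odd \<open>N\<close>, choosing between the two admissible shifts by the sign of \<open>m i\<close> makes them compatible
  with the relation \<open>m\<close>.\<close>

definition half_shift :: "int \<Rightarrow> int \<Rightarrow> int" where
  "half_shift N k = (if odd N \<and> 0 \<le> k then N div 2 + 1 else N div 2)"

text \<open>For even \<open>N\<close> all shifts equal \<open>N div 2\<close>, and the sum of the
  \<open>m i\<close> is even because it has the parity of \<open>N\<close>. For odd \<open>N\<close>
  twice a shift is \<open>N + 1\<close> or \<open>N - 1\<close> according to the sign of
  \<open>m i\<close>; the doubled sum is then a multiple of \<open>N\<close>, and 2 is coprime to
  \<open>N\<close>.\<close>

lemma half_shift_relation: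
  fixes m :: "nat \<Rightarrow> int"
  assumes N: "N = (\<Sum>i<r. \<bar>m i\<bar>)"
  shows "N dvd (\<Sum>i<r. m i * half_shift N (m i))"
proof -
  have parity: "even (\<Sum>i<r. m i) \<longleftrightarrow> even N"
    unfolding N by (induction r) auto
  show ?thesis
  proof (cases "even N")
    case True
    then obtain L where L: "N = 2 * L" by blast
    obtain M where M: "(\<Sum>i<r. m i) = 2 * M" using parity True by blast
    have "(\<Sum>i<r. m i * half_shift N (m i)) = (\<Sum>i<r. m i) * L"
      by (simp add: half_shift_def L sum_distrib_right)
    then show ?thesis by (simp add: M L)
  next
    case False
    have "2 * (m i * half_shift N (m i)) = m i * N + \<bar>m i\<bar>" for i
    proof -
      have "2 * half_shift N (m i) = (if 0 \<le> m i then N + 1 else N - 1)"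
        using False by (auto simp: half_shift_def elim!: oddE)
      then have "m i * (2 * half_shift N (m i)) = m i * (if 0 \<le> m i then N + 1 else N - 1)"
        by (simp only:)
      also have "\<dots> = m i * N + \<bar>m i\<bar>" by (auto simp: algebra_simps)
      finally show ?thesis by (simp only: mult.left_commute)
    qed
    then have "2 * (\<Sum>i<r. m i * half_shift N (m i)) = (\<Sum>i<r. m i * N + \<bar>m i\<bar>)"
      by (simp add: sum_distrib_left)
    also have "\<dots> = ((\<Sum>i<r. m i) + 1) * N"
      by (simp add: sum.distrib sum_distrib_right[symmetric] N[symmetric] distrib_right)
    finally have "N dvd 2 * (\<Sum>i<r. m i * half_shift N (m i))" by simp
    moreover have "coprime N 2" using False by simp
    ultimately show ?thesis using coprime_dvd_mult_right_iff by blast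
  qed
qed

text \<open>Two coefficient vectors of the same element differ by a multiple of \<open>m\<close>, so
  by \<open>dvd\<close> they give the same label modulo \<open>N\<close>.\<close>

lemma exists_label:
  fixes t :: "nat \<Rightarrow> 'a::ab_group_add"
  assumes "0 < N"
    and rel: "\<And>n. lincomb r t n = 0 \<Longrightarrow> \<exists>k. \<forall>i<r. n i = k * m i"
    and dvd: "N dvd (\<Sum>i<r. m i * \<theta> i)"
  obtains \<psi> :: "'a \<Rightarrow> int" where "\<And>h. \<psi> h \<in> {0..<N}"
    "\<And>h \<rho> i. h \<in> lattice_box r t \<rho> \<Longrightarrow> i < r \<Longrightarrow> \<psi> (h + t i) = (\<psi> h + \<theta> i) mod N"
proof -
  define f where "f n = (\<Sum>i<r. n i * \<theta> i) mod N" for n :: "nat \<Rightarrow> int"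
  have well: "f a = f b" if "lincomb r t a = lincomb r t b" for a b
  proof -
    have "lincomb r t (\<lambda>i. a i - b i) = 0" using that by (simp add: lincomb_diff)
    then obtain k where k: "\<And>i. i < r \<Longrightarrow> a i - b i = k * m i" using rel by blast
    have "(\<Sum>i<r. a i * \<theta> i) - (\<Sum>i<r. b i * \<theta> i) = (\<Sum>i<r. (a i - b i) * \<theta> i)"
      by (simp add: sum_subtractf left_diff_distrib)
    also have "\<dots> = (\<Sum>i<r. k * (m i * \<theta> i))" by (rule sum.cong) (auto simp: k)
    also have "\<dots> = k * (\<Sum>i<r. m i * \<theta> i)" by (simp add: sum_distrib_left)
    finally show ?thesis unfolding f_def mod_eq_dvd_iff using dvd by simp
  qed
  \<comment> \<open>Outside the generated subgroup \<open>SOME\<close> picks an arbitrary vector;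
    there only the range of \<open>\<psi>\<close> is claimed.\<close>
  define \<psi> where "\<psi> h = f (SOME n. lincomb r t n = h)" for h
  have \<psi>: "\<psi> (lincomb r t n) = f n" for n
    unfolding \<psi>_def by (rule well) (rule someI[of "\<lambda>a. lincomb r t a = lincomb r t n"], rule refl)
  show thesis
  proof (rule that)
    show "\<psi> h \<in> {0..<N}" for h using \<open>0 < N\<close> by (simp add: \<psi>_def f_def)
    fix h \<rho> i assume "h \<in> lattice_box r t \<rho>" and i: "i < r"
    then obtain n where n: "h = lincomb r t n" by (elim lattice_boxE)
    have "h + t i = lincomb r t (\<lambda>j. n j + of_bool (j = i))"
      using lincomb_unit[OF i, of t] by (simp add: lincomb_add n)
    then have "\<psi> (h + t i) = f (\<lambda>j. n j + of_bool (j = i))" by (simp add: \<psi>)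
    also have "\<dots> = ((\<Sum>j<r. n j * \<theta> j) + (\<Sum>j<r. of_bool (j = i) * \<theta> j)) mod N"
      by (simp add: f_def distrib_right sum.distrib)
    also have "(\<Sum>j<r. of_bool (j = i) * \<theta> j) = (\<Sum>j<r. if j = i then \<theta> j else 0)"
      by (rule sum.cong) auto
    also have "\<dots> = \<theta> i" using i by simp
    also have "((\<Sum>j<r. n j * \<theta> j) + \<theta> i) mod N = (\<psi> h + \<theta> i) mod N"
      by (simp add: n \<psi> f_def mod_add_left_eq)
    finally show "\<psi> (h + t i) = (\<psi> h + \<theta> i) mod N" .
  qed
qed

section \<open>The two bounds combined into the density formula\<close>

theorem theorem1p2:
  fixes \<mu> :: "'a::{topological_ab_group_add, t2_space} measure"
    and r :: nat and t :: "nat \<Rightarrow> 'a" and m :: "nat \<Rightarrow> int"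
  assumes "compact (UNIV :: 'a set)"
    and "haar_prob \<mu>"
    and "\<forall>i<r. t i \<noteq> 0"
    and "\<exists>i<r. m i \<noteq> 0"
    and "\<forall>n :: nat \<Rightarrow> int. (\<Sum>i<r. zsmul (n i) (t i)) = 0 \<longleftrightarrow> (\<exists>k::int. \<forall>i<r. n i = k * m i)"
  shows "motzkin_density \<mu> (t ` {..<r}) =
           real_of_int ((\<Sum>i<r. \<bar>m i\<bar>) div 2) / real_of_int (\<Sum>i<r. \<bar>m i\<bar>)"
proof -
  interpret translation_invariant_prob \<mu>
    using assms(2) by (simp add: haar_prob_def translation_invariant_prob_def
      translation_invariant_prob_axioms_def)
  define N where "N = (\<Sum>i<r. \<bar>m i\<bar>)"
  define \<theta> where "\<theta> i = half_shift N (m i)" for i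
  define c where "c = real_of_int (N div 2) / real_of_int N"
  have rel: "lincomb r t n = 0 \<longleftrightarrow> (\<exists>k. \<forall>i<r. n i = k * m i)" for n
    using assms(5) unfolding lincomb_def by (rule spec)
  have rel_m: "lincomb r t m = 0"
    unfolding rel by (rule exI[of _ 1]) simp
  obtain i where "i < r" "m i \<noteq> 0" using assms(4) by blast
  then have N_pos: "0 < N" unfolding N_def by (intro sum_pos2[of _ i]) auto
  have dvd: "N dvd (\<Sum>i<r. m i * \<theta> i)"
    unfolding \<theta>_def using N_def by (rule half_shift_relation)
  obtain \<psi> where \<psi>: "\<And>h. \<psi> h \<in> {0..<N}"
    "\<And>h \<rho> i. h \<in> lattice_box r t \<rho> \<Longrightarrow> i < r \<Longrightarrow> \<psi> (h + t i) = (\<psi> h + \<theta> i) mod N"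
    using exists_label[OF N_pos rel[THEN iffD1] dvd] by metis
  interpret labelled_generators \<mu> r t N \<theta> \<psi>
  proof unfold_locales
    show "0 < N" by (fact N_pos)
    show "\<psi> h \<in> {0..<N}" for h by (fact \<psi>(1))
    show "\<psi> (h + t i) = (\<psi> h + \<theta> i) mod N" if "h \<in> lattice_box r t \<rho>" "i < r" for h \<rho> i
      using that by (fact \<psi>(2))
  qed
  define S where
    "S = {measure \<mu> A | A. A \<in> sets borel \<and> {a - b | a b. a \<in> A \<and> b \<in> A} \<inter> t ` {..<r} = {}}"
  have S_I: "measure \<mu> A \<in> S"
    if "A \<in> sets borel" "{a - b | a b. a \<in> A \<and> b \<in> A} \<inter> t ` {..<r} = {}" for A
    unfolding S_def using that by (intro CollectI exI[of _ A] conjI refl)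
  have S_le: "s \<le> c" if s: "s \<in> S" for s
  proof -
    obtain A where A: "s = measure \<mu> A" "A \<in> sets borel"
      "{a - b | a b. a \<in> A \<and> b \<in> A} \<inter> t ` {..<r} = {}"
      using s unfolding S_def mem_Collect_eq by (elim exE conjE)
    show ?thesis
      using admissible_measure_le[OF A(2,3) rel_m] N_pos by (simp add: A(1) c_def N_def)
  qed
  have "measure \<mu> {} \<in> S" by (rule S_I) simp_all
  then have "S \<noteq> {}" by blast
  have bdd: "bdd_above S" using S_le by (rule bdd_aboveI)
  have "Sup S = c"
  proof (rule antisym)
    show "Sup S \<le> c" using \<open>S \<noteq> {}\<close> S_le by (rule cSup_least)
    \<comment> \<open>The construction reaches \<open>c\<close> up to the factor
      \<open>1 - \<delta>\<close>; letting \<open>\<delta>\<close> tend to 0 gives the bound for the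
      supremum.\<close>
    have lower: "c * (1 - \<delta>) \<le> Sup S" if \<delta>: "0 < \<delta>" for \<delta>
    proof -
      have half: "0 \<le> N div 2" "N div 2 \<le> N" using N_pos by auto
      \<comment> \<open>The shift is \<open>N div 2\<close> or, for odd \<open>N\<close>, possibly
        \<open>N div 2 + 1\<close>; since \<open>a\<close> is at most \<open>N div 2 - 1\<close>,
        the sum stays below \<open>N\<close> in either case.\<close>
      have shift: "N div 2 \<le> a + \<theta> i \<and> a + \<theta> i < N" if "i < r" "0 \<le> a" "a < N div 2" for i a
        using that by (auto simp: \<theta>_def half_shift_def elim!: oddE evenE)
      obtain A where A: "A \<in> sets borel" "{a - b | a b. a \<in> A \<and> b \<in> A} \<inter> t ` {..<r} = {}"
        "c * (1 - \<delta>) \<le> measure \<mu> A"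
        using exists_admissible_set[OF assms(1) \<delta> half shift] unfolding c_def .
      show ?thesis using A(3) cSup_upper[OF S_I[OF A(1,2)] bdd] by linarith
    qed
    have "((\<lambda>\<delta>. c * (1 - \<delta>)) \<longlongrightarrow> c * (1 - 0)) (at_right 0)" by (intro tendsto_intros)
    moreover have "eventually (\<lambda>\<delta>. c * (1 - \<delta>) \<le> Sup S) (at_right 0)"
      using lower by (auto simp: eventually_at_right_field intro: exI[of _ 1])
    ultimately have "c * (1 - 0) \<le> Sup S" by (rule tendsto_upperbound) simp
    then show "c \<le> Sup S" by simp
  qed
  then show ?thesis by (simp add: motzkin_density_def S_def c_def N_def)
qed

end
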